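(* Let $A$ be a finite alphabet of colors and $J$ a sentence over $A$. Then $$\mathfrak{S}^*_J=\sum_{C}L_{J,C}\,F_C,$$ where the sum runs over sentences $C$ with $|C|=|J|$ and $L_{J,C}$ is the number of standard colored immaculate tableaux of shape $J$ with colored descent composition $C$; in particular $\mathfrak{S}^*_J$ is a nonnegative combination of colored fundamental functions.
   Context: Words over $A$ are finite sequences of colors; a sentence is a finite sequence $I=(w_1,\dots,w_k)$ of nonempty words; $|I|$ is its number of letters and $w(I)=w_1\cdots w_k$. $J\preceq I$ means $w(J)=w(I)$ and $I$ arises from $J$ by concatenating some adjacent words. Let $x_{a,i}$ ($a\in A$, $i\in\mathbb{Z}_{>0}$) be variables subject only to $x_{a,i}x_{b,j}=x_{b,j}x_{a,i}$ for $i\ne j$; for a word $w=c_1\cdots c_r$, $x_{w,i}=x_{c_1,i}\cdots x_{c_r,i}$, $x_{\emptyset,i}=1$. $M_I=\sum_{j_1<\dots<j_k}x_{w_1,j_1}\cdots x_{w_k,j_k}$ and the colored fundamental function is $F_I=\sum_{J\preceq I}M_J$. For $J=(w_1,\dots,w_k)$ the colored composition diagram of shape $J$ has $k$ left-justified rows (row 1 on top), row $i$ having $|w_i|$ boxes colored in order by the letters of $w_i$. A colored immaculate tableau (CIT) of shape $J$ fills its boxes with positive integers, weakly increasing left to right in rows and strictly increasing top to bottom in the first column; its type is $(u_1,\dots,u_m)$ with $u_i$ the word of colors of the boxes containing $i$ read from the lowest row to the highest row and left to right within rows; $x_T=x_{u_1,1}\cdots x_{u_m,m}$ and $\mathfrak{S}^*_J=\sum_T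 x_T$ over all CIT of shape $J$. A standard CIT of size $n$ has entries $1,\dots,n$ each once; it has a descent at $i$ if $i+1$ is in a strictly lower row than $i$; its colored descent composition $co_A(U)$ is the sentence obtained by reading the box colors in order of entries $1,\dots,n$ and starting a new word after each descent. *)

theory Defs
  imports Main
begin

section \<open>Words and sentences\<close>

text \<open>A word is a list of colors, a sentence a list of nonempty words.\<close>

definition sentences :: "'a set \<Rightarrow> 'a list list set" where
  "sentences A = {I. \<forall>w\<in>set I. w \<noteq> [] \<and> set w \<subseteq> A}"

definition sentence_size :: "'a list list \<Rightarrow> nat" where
  "sentence_size I = length (concat I)"

text \<open>The list \<open>B\<close> groups the words of \<open>J\<close> into nonempty blocks of adjacent words; each
  block is concatenated to one word of \<open>I\<close>.\<close>

definition refines :: "'a list list \<Rightarrow> 'a list list \<Rightarrow> bool" (infix \<open>\<preceq>\<close> 50) where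
  "J \<preceq> I \<longleftrightarrow> concat J = concat I \<and>
     (\<exists>B. [] \<notin> set B \<and> concat B = J \<and> map concat B = I)"


section \<open>Monomials and series in partially commuting variables\<close>

text \<open>The monomials form the free monoid on the variables \<open>(a, i)\<close> modulo the congruence
  generated by commuting adjacent variables with distinct indices. The index \<open>0\<close>
  is available in the type, but the series below use positive indices only.\<close>

inductive commute_step :: "('a \<times> nat) list \<Rightarrow> ('a \<times> nat) list \<Rightarrow> bool" where
  "i \<noteq> j \<Longrightarrow> commute_step (us @ (a, i) # (b, j) # vs) (us @ (b, j) # (a, i) # vs)"

quotient_type 'a pc_monomial = "('a \<times> nat) list" / "equivclp commute_step"
  by (intro equivpI reflpI sympI transpI equivclp_refl)
    (fact equivclp_sym, fact equivclp_trans)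

lemma commute_step_append:
  assumes "commute_step u v" shows "commute_step (p @ u @ q) (p @ v @ q)"
  using assms
proof cases
  case (1 i j us a b vs)
  then show ?thesis
    using commute_step.intros[OF 1(3), of "p @ us" a b "vs @ q"] by simp
qed

lemma equivclp_commute_append:
  assumes "equivclp commute_step u v"
  shows "equivclp commute_step (p @ u @ q) (p @ v @ q)"
  using assms
proof (induction rule: equivclp_induct)
  case base
  then show ?case by simp
next
  case (step y z)
  from step.hyps(2)
  have "commute_step (p @ y @ q) (p @ z @ q) \<or> commute_step (p @ z @ q) (p @ y @ q)"
    using commute_step_append[of y z p q] commute_step_append[of z y p q] by iprover
  with step.IH show ?case by (rule equivclp_into_equivclp)
qed

instantiation pc_monomial :: (type) monoid_mult
begin

lift_definition one_pc_monomial :: "'a pc_monomial" is "[]" .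

lift_definition times_pc_monomial :: "'a pc_monomial \<Rightarrow> 'a pc_monomial \<Rightarrow> 'a pc_monomial"
  is "(@)"
proof -
  fix u u' v v' :: "('a \<times> nat) list"
  assume u: "equivclp commute_step u u'" and v: "equivclp commute_step v v'"
  have "equivclp commute_step (u @ v) (u' @ v)"
    using equivclp_commute_append[OF u, of "[]" v] by simp
  moreover have "equivclp commute_step (u' @ v) (u' @ v')"
    using equivclp_commute_append[OF v, of u' "[]"] by simp
  ultimately show "equivclp commute_step (u @ v) (u' @ v')"
    by (rule equivclp_trans)
qed

instance
proof
  fix a b c :: "'a pc_monomial"
  show "a * b * c = a * (b * c)" by transfer simp
  show "1 * a = a" by transfer simp
  show "a * 1 = a" by transfer simp
qed

end

lift_definition pc_var :: "'a \<Rightarrow> nat \<Rightarrow> 'a pc_monomial" is "\<lambda>a i. [(a, i)]" .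

lemma pc_var_commute:
  assumes "i \<noteq> j" shows "pc_var a i * pc_var b j = pc_var b j * pc_var a i"
proof -
  have "commute_step [(a, i), (b, j)] [(b, j), (a, i)]"
    using commute_step.intros[OF assms, of "[]" a b "[]"] by simp
  then have "equivclp commute_step [(a, i), (b, j)] [(b, j), (a, i)]"
    by (rule r_into_equivclp)
  then show ?thesis by transfer simp
qed

definition word_monomial :: "'a list \<Rightarrow> nat \<Rightarrow> 'a pc_monomial" where
  "word_monomial w i = prod_list (map (\<lambda>c. pc_var c i) w)"

text \<open>A formal power series is its coefficient function. The formal sum of the monomials
  \<open>f s\<close> for \<open>s \<in> S\<close> is meaningful if every monomial occurs only finitely often;
  this is proved below wherever \<open>monomial_sum\<close> is used.\<close>

type_synonym ('a, 'r) pc_series = "'a pc_monomial \<Rightarrow> 'r"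

definition monomial_sum :: "'s set \<Rightarrow> ('s \<Rightarrow> 'a pc_monomial) \<Rightarrow> ('a, 'r::comm_ring_1) pc_series" where
  "monomial_sum S f = (\<lambda>m. of_nat (card {s \<in> S. f s = m}))"


section \<open>Colored monomial and fundamental functions\<close>

definition index_seqs :: "nat \<Rightarrow> nat list set" where
  "index_seqs k = {js. length js = k \<and> sorted_wrt (<) js \<and> (\<forall>j\<in>set js. 0 < j)}"

definition colored_M :: "'a list list \<Rightarrow> ('a, 'r::comm_ring_1) pc_series" where
  "colored_M I = monomial_sum (index_seqs (length I)) (\<lambda>js. prod_list (map2 word_monomial I js))"

definition colored_F :: "'a list list \<Rightarrow> ('a, 'r::comm_ring_1) pc_series" where
  "colored_F I = (\<lambda>m. \<Sum>J | J \<in> sentences UNIV \<and> J \<preceq> I. colored_M J m)"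


section \<open>Colored immaculate tableaux\<close>

text \<open>A filling is the list of its rows from top to bottom, so the colors of the boxes of row \<open>r\<close>
  are \<open>J ! r\<close> and their entries are \<open>T ! r\<close>. As the rows of a sentence are nonempty,
  \<open>map hd T\<close> is the first column.\<close>

definition CIT :: "'a list list \<Rightarrow> nat list list \<Rightarrow> bool" where
  "CIT J T \<longleftrightarrow> map length T = map length J
     \<and> (\<forall>row\<in>set T. sorted row \<and> (\<forall>x\<in>set row. 0 < x))
     \<and> sorted_wrt (<) (map hd T)"

text \<open>The colors of the boxes with entry \<open>i\<close>; \<open>rev\<close> makes the lowest row come first.\<close>

definition type_word :: "'a list list \<Rightarrow> nat list list \<Rightarrow> nat \<Rightarrow> 'a list" where
  "type_word J T i =
     concat (rev (map2 (\<lambda>w row. map fst (filter (\<lambda>(c, x). x = i) (zip w row))) J T))"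

definition max_entry :: "nat list list \<Rightarrow> nat" where
  "max_entry T = Max (insert 0 (set (concat T)))"

definition tableau_type :: "'a list list \<Rightarrow> nat list list \<Rightarrow> 'a list list" where
  "tableau_type J T = map (type_word J T) [1..<Suc (max_entry T)]"

definition tableau_monomial :: "'a list list \<Rightarrow> nat list list \<Rightarrow> 'a pc_monomial" where
  "tableau_monomial J T =
     prod_list (map2 word_monomial (tableau_type J T) [1..<Suc (max_entry T)])"

definition dual_immaculate :: "'a list list \<Rightarrow> ('a, 'r::comm_ring_1) pc_series" where
  "dual_immaculate J = monomial_sum {T. CIT J T} (tableau_monomial J)"

definition standard_CIT :: "'a list list \<Rightarrow> nat list list \<Rightarrow> bool" where
  "standard_CIT J T \<longleftrightarrow> CIT J T \<and> distinct (concat T) \<and> set (concat T) = {1..sentence_size J}"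

definition descent :: "nat list list \<Rightarrow> nat \<Rightarrow> bool" where
  "descent T i \<longleftrightarrow> (\<exists>r s. r < s \<and> s < length T \<and> i \<in> set (T ! r) \<and> Suc i \<in> set (T ! s))"

definition entry_color :: "'a list list \<Rightarrow> nat list list \<Rightarrow> nat \<Rightarrow> 'a" where
  "entry_color J T i =
     (THE c. \<exists>r k. r < length J \<and> k < length (J ! r) \<and> T ! r ! k = i \<and> J ! r ! k = c)"

primrec split_after :: "('b \<Rightarrow> bool) \<Rightarrow> 'b list \<Rightarrow> 'b list list" where
  "split_after P [] = []"
| "split_after P (x # xs) =
     (if xs = [] \<or> P x then [x] # split_after P xs
      else (x # hd (split_after P xs)) # tl (split_after P xs))"

definition descent_composition :: "'a list list \<Rightarrow> nat list list \<Rightarrow> 'a list list" where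
  "descent_composition J U =
     map (map (entry_color J U)) (split_after (descent U) [1..<Suc (sentence_size J)])"

definition immaculate_L :: "'a list list \<Rightarrow> 'a list list \<Rightarrow> nat" where
  "immaculate_L J C = card {U. standard_CIT J U \<and> descent_composition J U = C}"


section \<open>Finiteness of the index sets\<close>

lemma finite_sentences_size:
  assumes "finite A"
  shows "finite {C \<in> sentences A. sentence_size C = n}"
proof -
  let ?W = "{w. set w \<subseteq> A \<and> length w \<le> n}"
  have "{C \<in> sentences A. sentence_size C = n} \<subseteq> {C. set C \<subseteq> ?W \<and> length C \<le> n}"
  proof safe
    fix C assume C: "C \<in> sentences A" "n = sentence_size C"
    show "length C \<le> sentence_size C"
      using C(1)
    proof (induction C)
      case (Cons w C)
      then have "length C \<le> sentence_size C" and "0 < length w"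
        by (auto simp: sentences_def)
      then show ?case by (cases w) (auto simp: sentence_size_def)
    qed (simp add: sentence_size_def)
    fix w assume w: "w \<in> set C"
    then show "length w \<le> sentence_size C"
      by (simp add: sentence_size_def length_concat member_le_sum_list)
    fix x assume "x \<in> set w" then show "x \<in> A"
      using w C(1) by (auto simp: sentences_def)
  qed
  then show ?thesis
    by (rule finite_subset) (intro finite_lists_length_le assms)
qed

lemma finite_refinements: "finite {J. J \<in> sentences UNIV \<and> J \<preceq> I}"
proof (rule finite_subset)
  show "{J. J \<in> sentences UNIV \<and> J \<preceq> I}
      \<subseteq> {J \<in> sentences (set (concat I)). sentence_size J = sentence_size I}"
  proof safe
    fix J assume J: "J \<in> sentences UNIV" "J \<preceq> I"
    then have eq: "concat J = concat I" by (simp add: refines_def)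
    then show "sentence_size J = sentence_size I" by (simp add: sentence_size_def)
    show "J \<in> sentences (set (concat I))"
      using J(1) unfolding sentences_def eq[symmetric] by auto
  qed
qed (rule finite_sentences_size, simp)

lift_definition indices :: "'a pc_monomial \<Rightarrow> nat set" is "\<lambda>u. snd ` set u"
proof -
  fix u v :: "('a \<times> nat) list"
  assume "equivclp commute_step u v"
  then show "snd ` set u = snd ` set v"
    by (induction rule: equivclp_induct) (auto elim!: commute_step.cases)
qed

lemma indices_one [simp]: "indices 1 = {}"
  by transfer simp

lemma indices_times [simp]: "indices (m * n) = indices m \<union> indices n"
  by transfer auto

lemma finite_indices: "finite (indices m)"
  by transfer simp

lemma indices_prod_list: "indices (prod_list ms) = (\<Union>m\<in>set ms. indices m)"
  by (induction ms) auto

lemma indices_word_monomial: "indices (word_monomial w i) = (if w = [] then {} else {i})"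
proof -
  have "indices (pc_var c i) = {i}" for c :: 'a by transfer simp
  then show ?thesis by (auto simp: word_monomial_def indices_prod_list)
qed

lemma finite_colored_M_fiber:
  assumes "I \<in> sentences A"
  shows "finite {js \<in> index_seqs (length I). prod_list (map2 word_monomial I js) = m}"
proof (rule finite_subset)
  show "{js \<in> index_seqs (length I). prod_list (map2 word_monomial I js) = m}
      \<subseteq> {js. set js \<subseteq> indices m \<and> length js = length I}"
  proof safe
    fix js j assume js: "js \<in> index_seqs (length I)" and j: "j \<in> set js"
    then obtain k where k: "k < length js" "j = js ! k" by (auto simp: in_set_conv_nth)
    have len: "length js = length I" using js by (simp add: index_seqs_def)
    then have "I ! k \<noteq> []" using k assms by (auto simp: sentences_def)
    moreover have "(I ! k, j) \<in> set (zip I js)"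
      using k len by (auto simp: in_set_zip)
    ultimately show "j \<in> indices (prod_list (map2 word_monomial I js))"
      unfolding indices_prod_list
      by (intro UN_I[of "word_monomial (I ! k) j"]) (auto simp: indices_word_monomial)
  qed (simp add: index_seqs_def)
  show "finite {js. set js \<subseteq> indices m \<and> length js = length I}"
    using finite_indices by (rule finite_lists_length_eq)
qed

lemma finite_bounded_fillings:
  assumes "finite E"
  shows "finite {T. map length T = map length J \<and> set (concat T) \<subseteq> E}"
proof (rule finite_subset)
  let ?W = "{row. set row \<subseteq> E \<and> length row \<le> sum_list (map length J)}"
  show "{T. map length T = map length J \<and> set (concat T) \<subseteq> E}
      \<subseteq> {T. set T \<subseteq> ?W \<and> length T = length J}"
  proof safe
    fix T assume T: "map length T = map length J" "set (concat T) \<subseteq> E"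
    show "length T = length J" using map_eq_imp_length_eq[OF T(1)] .
    fix row assume row: "row \<in> set T"
    then have "length row \<in> set (map length J)" unfolding T(1)[symmetric] by simp
    then show "length row \<le> sum_list (map length J)" by (rule member_le_sum_list) simp
    fix x assume "x \<in> set row" then show "x \<in> E" using T(2) row by auto
  qed
  show "finite {T. set T \<subseteq> ?W \<and> length T = length J}"
    using assms by (intro finite_lists_length_eq finite_lists_length_le)
qed

lemma type_word_nonempty:
  assumes "map length T = map length J" "i \<in> set (concat T)"
  shows "type_word J T i \<noteq> []"
proof -
  obtain row where "row \<in> set T" "i \<in> set row" using assms(2) by auto
  then obtain r k where r: "r < length T" "k < length (T ! r)" "T ! r ! k = i"
    by (auto simp: in_set_conv_nth)
  have len: "length T = length J" using map_eq_imp_length_eq[OF assms(1)] .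
  have "length (T ! r) = length (J ! r)"
    using arg_cong[OF assms(1), of "\<lambda>xs. xs ! r"] r(1) len by simp
  then have "(J ! r ! k, i) \<in> set (zip (J ! r) (T ! r))"
    using r by (auto simp: in_set_zip)
  moreover have "(J ! r, T ! r) \<in> set (zip J T)"
    using r len by (auto simp: in_set_zip)
  ultimately show ?thesis
    unfolding type_word_def concat_eq_Nil_conv set_rev list.set_map ball_simps
    by (auto simp: filter_empty_conv split_beta intro!: bexI[of _ "(J ! r, T ! r)"] bexI[of _ "(J ! r ! k, i)"])
qed

lemma finite_dual_immaculate_fiber: "finite {T. CIT J T \<and> tableau_monomial J T = m}"
proof (rule finite_subset)
  show "{T. CIT J T \<and> tableau_monomial J T = m}
      \<subseteq> {T. map length T = map length J \<and> set (concat T) \<subseteq> indices m}"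
  proof (intro subsetI CollectI conjI; elim CollectE conjE)
    fix T x assume T: "CIT J T" "tableau_monomial J T = m" and x: "x \<in> set (concat T)"
    have len: "map length T = map length J" and pos: "0 < x"
      using T(1) x by (auto simp: CIT_def)
    have "x \<le> max_entry T" unfolding max_entry_def using x by (intro Max_ge) auto
    then have "x \<in> set [1..<Suc (max_entry T)]" using pos by auto
    moreover have "map2 word_monomial (map f xs) xs = map (\<lambda>i. word_monomial (f i) i) xs"
      for f :: "nat \<Rightarrow> 'a list" and xs
      by (induction xs) auto
    then have "indices m =
        (\<Union>i\<in>set [1..<Suc (max_entry T)]. indices (word_monomial (type_word J T i) i))"
      unfolding T(2)[symmetric] tableau_monomial_def tableau_type_def
      by (simp only: indices_prod_list list.set_map image_image UN_simps)
    ultimately show "x \<in> indices m"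
      using type_word_nonempty[OF len x] by (auto simp: indices_word_monomial simp del: upt_Suc)
  qed (simp add: CIT_def)
qed (rule finite_bounded_fillings, rule finite_indices)

lemma finite_standard_CIT: "finite {U. standard_CIT J U}"
  by (rule finite_subset[OF _ finite_bounded_fillings[of "{1..sentence_size J}" J]])
    (auto simp: standard_CIT_def CIT_def)

end

theory Submission
  imports Defs
begin

text \<open>Gessel's argument with colors. Order the boxes of a tableau \<open>T\<close> by entry, breaking ties by the
  reading order (lower rows first, left to right in a row); numbering them in this order gives the
  standardization \<open>U\<close> of \<open>T\<close>. The entries of \<open>T\<close> along this order form a weakly increasing sequence
  that jumps at every descent of \<open>U\<close>, and every such sequence arises from exactly one \<open>T\<close>, because a
  tie between consecutive boxes is consistent with the reading order precisely when \<open>U\<close> has no descent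
  there. On the other side, \<open>F_C\<close> enumerates exactly the weakly increasing index sequences that jump
  at the word breaks of \<open>C\<close>: the maximal constant runs of such a sequence cut \<open>C\<close> into the refinement
  \<open>J\<close> whose monomial function \<open>M_J\<close> contributes the term.\<close>

section \<open>Fundamental functions as sums over compatible lists\<close>

text \<open>A monomial forgets the order of commuting variables, so all counting is done on lists of
  letters with indices; the monomial enters only as the label of such a list.\<close>

definition pairs_monomial :: "('a \<times> nat) list \<Rightarrow> 'a pc_monomial" where
  "pairs_monomial ps = prod_list (map (\<lambda>(c, i). pc_var c i) ps)"

lemma pairs_monomial_append: "pairs_monomial (ps @ qs) = pairs_monomial ps * pairs_monomial qs"
  by (simp add: pairs_monomial_def)

lemma pairs_monomial_concat: "pairs_monomial (concat pss) = prod_list (map pairs_monomial pss)"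
  by (induction pss) (simp_all add: pairs_monomial_def)

lemma word_monomial_eq: "word_monomial w i = pairs_monomial (map (\<lambda>c. (c, i)) w)"
  by (simp add: word_monomial_def pairs_monomial_def comp_def)

text \<open>The term of \<open>colored_M K\<close> at \<open>js\<close>, kept as a list before any
  variables commute.\<close>

definition expand :: "'a list list \<Rightarrow> nat list \<Rightarrow> ('a \<times> nat) list" where
  "expand K js = concat (map2 (\<lambda>w j. map (\<lambda>c. (c, j)) w) K js)"

lemma expand_simps [simp]:
  "expand [] js = []" "expand K [] = []"
  "expand (w # K) (j # js) = map (\<lambda>c. (c, j)) w @ expand K js"
  by (simp_all add: expand_def)

lemma expand_append:
  "length K = length js \<Longrightarrow> expand (K @ K') (js @ js') = expand K js @ expand K' js'"
  by (simp add: expand_def)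

lemma prod_list_word_monomial:
  "prod_list (map2 word_monomial K js) = pairs_monomial (expand K js)"
proof (induction K arbitrary: js)
  case (Cons w K)
  then show ?case
    by (cases js) (simp_all add: word_monomial_eq pairs_monomial_append pairs_monomial_def)
qed (simp add: pairs_monomial_def)

lemma map_fst_expand: "length K = length js \<Longrightarrow> map fst (expand K js) = concat K"
  by (induction rule: list_induct2) (simp_all add: comp_def)

lemma snd_expand_subset: "snd ` set (expand K js) \<subseteq> set js"
  unfolding expand_def by (auto dest: set_zip_rightD)

text \<open>An empty word would make its index disappear from the list, hence the restriction to
  nonempty words.\<close>

lemma snd_expand:
  "length K = length js \<Longrightarrow> [] \<notin> set K \<Longrightarrow> snd ` set (expand K js) = set js"
  by (induction rule: list_induct2) (auto simp: image_Un image_image image_constant_conv)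

lemma sorted_expand:
  "length K = length js \<Longrightarrow> sorted js \<Longrightarrow> sorted (map snd (expand K js))"
proof (induction rule: list_induct2)
  case (Cons w K j js)
  then show ?case using snd_expand_subset[of K js]
    by (fastforce simp: sorted_append comp_def map_replicate_const)
qed simp

lemma sentences_UNIV: "K \<in> sentences UNIV \<longleftrightarrow> [] \<notin> set K"
  by (auto simp: sentences_def)

text \<open>The indices strictly increase and no word is empty, so the words of \<open>K\<close> are
  the maximal runs of constant index. Both \<open>K\<close> and \<open>js\<close> can be read off
  the list one run at a time.\<close>

lemma expand_inject:
  assumes "[] \<notin> set K" "js \<in> index_seqs (length K)"
    and "[] \<notin> set K'" "js' \<in> index_seqs (length K')"
    and "expand K js = expand K' js'"
  shows "K = K' \<and> js = js'"
  using assms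
proof (induction K arbitrary: js K' js')
  case Nil
  then show ?case by (cases K'; cases js') (auto simp: index_seqs_def)
next
  case (Cons w K)
  obtain j ks where js: "js = j # ks" using Cons.prems(2) by (cases js) (auto simp: index_seqs_def)
  obtain w' L where K': "K' = w' # L" using Cons.prems js by (cases K') auto
  obtain j' ks' where js': "js' = j' # ks'"
    using Cons.prems(4) K' by (cases js') (auto simp: index_seqs_def)
  have ne: "w \<noteq> []" "w' \<noteq> []" using Cons.prems K' by auto
  have eq: "map (\<lambda>c. (c, j)) w @ expand K ks = map (\<lambda>c. (c, j')) w' @ expand L ks'"
    using Cons.prems(5) by (simp add: js js' K')
  then have "j = j'" using ne by (cases w; cases w') auto
  have gt: "\<forall>k\<in>set ks. j < k" "\<forall>k\<in>set ks'. j < k"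
    using Cons.prems(2,4) \<open>j = j'\<close> by (auto simp: js js' index_seqs_def)
  have later: "\<forall>p\<in>set (expand M ls). snd p \<noteq> j" if "\<forall>k\<in>set ls. j < k"
    for M :: "'a list list" and ls
    using snd_expand_subset[of M ls] that by fastforce
  \<comment> \<open>All later indices exceed \<open>j\<close>, so \<open>takeWhile\<close> cuts off
    precisely the first run.\<close>
  have run: "takeWhile (\<lambda>p. snd p = j) (map (\<lambda>c. (c, j)) v @ es) = map (\<lambda>c. (c, j)) v"
    if "\<forall>p\<in>set es. snd p \<noteq> j" for v :: "'a list" and es
    using that by (induction v) (auto simp: takeWhile_eq_Nil_iff)
  have "map (\<lambda>c. (c, j)) w = map (\<lambda>c. (c, j)) w'"
    using arg_cong[OF eq, of "takeWhile (\<lambda>p. snd p = j)"] \<open>j = j'\<close> run later gt by metis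
  then have "w = w'" by (auto dest: map_injective simp: inj_def)
  with eq \<open>j = j'\<close> have "expand K ks = expand L ks'" by simp
  then have "K = L \<and> ks = ks'"
    using Cons.prems by (intro Cons.IH) (auto simp: js js' K' index_seqs_def)
  then show ?case by (simp add: js js' K' \<open>j = j'\<close> \<open>w = w'\<close>)
qed

text \<open>A letter put in front of a sorted list either joins the first run, if it has the same
  index, or opens a new run with a smaller index.\<close>

lemma expand_surj:
  assumes "sorted (map snd ps)" "\<forall>p\<in>set ps. 0 < snd p"
  shows "\<exists>K js. [] \<notin> set K \<and> js \<in> index_seqs (length K) \<and> expand K js = ps"
  using assms
proof (induction ps)
  case Nil
  show ?case by (rule exI[of _ "[]"], rule exI[of _ "[]"]) (simp add: index_seqs_def)
next
  case (Cons p ps)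
  obtain a i where p: "p = (a, i)" by (cases p)
  obtain K js where K: "[] \<notin> set K" "js \<in> index_seqs (length K)" "expand K js = ps"
    using Cons by auto
  have le: "\<forall>j\<in>set js. i \<le> j"
    using Cons.prems(1) snd_expand[of K js, symmetric] K by (auto simp: p index_seqs_def)
  show ?case
  proof (cases "i \<in> set js")
    case True
    then obtain j ks where js: "js = j # ks" by (cases js) auto
    then obtain w L where KL: "K = w # L" using K(2) by (cases K) (auto simp: index_seqs_def)
    \<comment> \<open>As \<open>i\<close> occurs in the strictly increasing \<open>js\<close> and
      bounds it from below, it is the first index.\<close>
    have "j = i" using True K(2) le by (force simp: js index_seqs_def)
    then show ?thesis
      using K by (intro exI[of _ "(a # w) # L"] exI[of _ js]) (auto simp: js KL p index_seqs_def)
  next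
    case False
    then have "\<forall>j\<in>set js. i < j" using le by (metis nat_less_le)
    then show ?thesis
      using K Cons.prems by (intro exI[of _ "[a] # K"] exI[of _ "i # js"]) (auto simp: p index_seqs_def)
  qed
qed

text \<open>These lists describe the terms of \<open>colored_F C\<close> without mentioning a
  refinement. The witness \<open>Ps\<close> is forced by the list and the word lengths of
  \<open>C\<close>; quantifying over it avoids computing cut positions.\<close>

definition compatible :: "'a list list \<Rightarrow> ('a \<times> nat) list set" where
  "compatible C = {ps. sorted (map snd ps) \<and> (\<forall>p\<in>set ps. 0 < snd p) \<and>
     (\<exists>Ps. concat Ps = ps \<and> map (map fst) Ps = C \<and>
        sorted_wrt (\<lambda>p q. \<forall>x\<in>set p. \<forall>y\<in>set q. snd x < snd y) Ps)}"

text \<open>Grouping the words of a refinement by \<open>B\<close> groups their indices too. Since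
  \<open>js\<close> increases strictly across all words, the resulting blocks are strictly
  separated.\<close>

lemma expand_concat_blocks:
  assumes "sorted_wrt (<) js" "length js = length (concat B)"
  shows "\<exists>Ps. concat Ps = expand (concat B) js \<and> map (map fst) Ps = map concat B \<and>
        sorted_wrt (\<lambda>p q. \<forall>x\<in>set p. \<forall>y\<in>set q. snd x < snd y) Ps"
  using assms
proof (induction B arbitrary: js)
  case (Cons b B)
  \<comment> \<open>\<open>ks\<close> holds the indices of the words grouped in \<open>b\<close>,
    \<open>ls\<close> those of the remaining groups.\<close>
  define ks ls where "ks = take (length b) js" and "ls = drop (length b) js"
  have js: "js = ks @ ls" and len: "length ks = length b" "length ls = length (concat B)"
    using Cons.prems(2) by (auto simp: ks_def ls_def)
  have less: "sorted_wrt (<) ls" "\<forall>x\<in>set ks. \<forall>y\<in>set ls. x < y"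
    using Cons.prems(1) by (auto simp: js sorted_wrt_append)
  obtain Ps where Ps: "concat Ps = expand (concat B) ls" "map (map fst) Ps = map concat B"
      "sorted_wrt (\<lambda>p q. \<forall>x\<in>set p. \<forall>y\<in>set q. snd x < snd y) Ps"
    using Cons.IH[OF less(1) len(2)] by blast
  have "snd x < snd y" if "x \<in> set (expand b ks)" "q \<in> set Ps" "y \<in> set q" for x y q
  proof -
    have "y \<in> set (expand (concat B) ls)" using that unfolding Ps(1)[symmetric] by auto
    then have "snd x \<in> set ks" "snd y \<in> set ls"
      using that(1) snd_expand_subset[of b ks] snd_expand_subset[of "concat B" ls] by auto
    then show ?thesis using less(2) by blast
  qed
  then show ?case
    using Ps len by (intro exI[of _ "expand b ks # Ps"]) (simp add: js expand_append map_fst_expand)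
qed simp

text \<open>Converse of the grouping: each block is cut into its own runs by
  \<open>expand_surj\<close>. Strict separation prevents a run from crossing a block boundary, so
  the index lists of the blocks concatenate to a strictly increasing one.\<close>

lemma blocks_expand:
  assumes "\<forall>p\<in>set (concat Ps). 0 < snd p" "sorted (map snd (concat Ps))" "[] \<notin> set Ps"
    and "sorted_wrt (\<lambda>p q. \<forall>x\<in>set p. \<forall>y\<in>set q. snd x < snd y) Ps"
  shows "\<exists>B js. [] \<notin> set B \<and> map concat B = map (map fst) Ps \<and> [] \<notin> set (concat B) \<and>
           js \<in> index_seqs (length (concat B)) \<and> expand (concat B) js = concat Ps"
  using assms
proof (induction Ps)
  case Nil
  show ?case by (rule exI[of _ "[]"], rule exI[of _ "[]"]) (simp add: index_seqs_def)
next
  case (Cons p Ps)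
  have "\<exists>B js. [] \<notin> set B \<and> map concat B = map (map fst) Ps \<and> [] \<notin> set (concat B) \<and>
           js \<in> index_seqs (length (concat B)) \<and> expand (concat B) js = concat Ps"
    using Cons.prems by (intro Cons.IH) (auto simp: sorted_append)
  then obtain B js where B: "[] \<notin> set B" "map concat B = map (map fst) Ps" "[] \<notin> set (concat B)"
      "js \<in> index_seqs (length (concat B))" "expand (concat B) js = concat Ps" by blast
  obtain K ks where K: "[] \<notin> set K" "ks \<in> index_seqs (length K)" "expand K ks = p"
    using expand_surj[of p] Cons.prems by (auto simp: sorted_append)
  have len: "length K = length ks" "length (concat B) = length js"
    using K(2) B(4) by (simp_all add: index_seqs_def)
  have sets: "set ks = snd ` set p" "set js = snd ` set (concat Ps)"
    using snd_expand[OF len(1) K(1)] snd_expand[OF len(2) B(3)] K(3) B(5) by auto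
  have "\<forall>x\<in>set ks. \<forall>y\<in>set js. x < y" unfolding sets using Cons.prems(4) by auto
  then have "ks @ js \<in> index_seqs (length (concat (K # B)))"
    using K(2) B(4) by (auto simp: index_seqs_def sorted_wrt_append)
  moreover have "K \<noteq> []" using K(3) Cons.prems(3) by auto
  moreover have "expand (concat (K # B)) (ks @ js) = concat (p # Ps)"
    using len by (simp add: expand_append K B)
  moreover have "concat K = map fst p" using map_fst_expand[OF len(1)] K(3) by simp
  ultimately show ?case using B K by (intro exI[of _ "K # B"] exI[of _ "ks @ js"]) auto
qed

text \<open>A pair of a refinement of \<open>C\<close> and an index sequence is one term of the
  fundamental function; here these terms are identified with lists in which the refinement is no
  longer visible.\<close>

lemma expand_image:
  assumes "[] \<notin> set C"
  shows "(\<lambda>(K, js). expand K js) `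
      {(K, js). [] \<notin> set K \<and> K \<preceq> C \<and> js \<in> index_seqs (length K)} = compatible C"
proof (intro equalityI subsetI)
  fix ps assume "ps \<in> (\<lambda>(K, js). expand K js) `
      {(K, js). [] \<notin> set K \<and> K \<preceq> C \<and> js \<in> index_seqs (length K)}"
  then obtain K js where K: "K \<preceq> C" "js \<in> index_seqs (length K)" "ps = expand K js" by auto
  then obtain B where B: "concat B = K" "map concat B = C" by (auto simp: refines_def)
  have js: "sorted_wrt (<) js" "length K = length js" "\<forall>j\<in>set js. 0 < j"
    using K(2) by (auto simp: index_seqs_def)
  then have "sorted (map snd ps)" unfolding K(3)
    by (intro sorted_expand) (auto simp: strict_sorted_imp_sorted)
  moreover have "\<forall>p\<in>set ps. 0 < snd p"
    using js(3) snd_expand_subset[of K js] by (auto simp: K(3))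
  ultimately show "ps \<in> compatible C"
    using expand_concat_blocks[OF js(1), of B] js(2) by (simp add: compatible_def B K(3))
next
  fix ps assume "ps \<in> compatible C"
  then obtain Ps where Ps: "sorted (map snd (concat Ps))" "\<forall>p\<in>set (concat Ps). 0 < snd p"
      "concat Ps = ps" "map (map fst) Ps = C"
      "sorted_wrt (\<lambda>p q. \<forall>x\<in>set p. \<forall>y\<in>set q. snd x < snd y) Ps"
    by (auto simp: compatible_def)
  \<comment> \<open>Nonempty words of \<open>C\<close> force nonempty blocks, as the groups in the
    definition of \<open>refines\<close> must be nonempty.\<close>
  have "[] \<notin> set Ps" using assms by (auto simp: Ps(4)[symmetric] image_iff)
  then obtain B js where B: "[] \<notin> set B" "map concat B = C" "[] \<notin> set (concat B)"
      "js \<in> index_seqs (length (concat B))" "expand (concat B) js = ps"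
    using blocks_expand[OF Ps(2,1) _ Ps(5)] Ps(3,4) by auto
  moreover have "concat (concat B) = concat (map concat B)" by (induction B) simp_all
  ultimately have "concat B \<preceq> C" unfolding refines_def by auto
  then have "(concat B, js) \<in> {(K, js). [] \<notin> set K \<and> K \<preceq> C \<and> js \<in> index_seqs (length K)}"
    using B by blast
  then show "ps \<in> (\<lambda>(K, js). expand K js) `
      {(K, js). [] \<notin> set K \<and> K \<preceq> C \<and> js \<in> index_seqs (length K)}"
    using B(5) by force
qed

text \<open>The sum over refinements of the numbers of index sequences is the size of a
  \<open>Sigma\<close> set, which the injective map \<open>expand\<close> carries onto the
  compatible lists with monomial \<open>m\<close>.\<close>

lemma colored_F_eq_card_compatible:
  assumes "[] \<notin> set C"
  shows "colored_F C m = of_nat (card {ps \<in> compatible C. pairs_monomial ps = m})"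
proof -
  let ?R = "{K. K \<in> sentences UNIV \<and> K \<preceq> C}"
  let ?S = "\<lambda>K. {js \<in> index_seqs (length K). prod_list (map2 word_monomial K js) = m}"
  have "colored_F C m = (\<Sum>K\<in>?R. of_nat (card (?S K)))"
    by (simp add: colored_F_def colored_M_def monomial_sum_def)
  also have "\<dots> = of_nat (card (Sigma ?R ?S))"
  proof -
    have "card (Sigma ?R ?S) = (\<Sum>K\<in>?R. card (?S K))"
      by (intro card_SigmaI finite_refinements) (auto intro: finite_colored_M_fiber)
    then show ?thesis by simp
  qed
  also have "card (Sigma ?R ?S) = card ((\<lambda>(K, js). expand K js) ` Sigma ?R ?S)"
    by (intro card_image[symmetric])
      (auto simp: inj_on_def sentences_UNIV dest: expand_inject)
  also have "(\<lambda>(K, js). expand K js) ` Sigma ?R ?S = {ps \<in> compatible C. pairs_monomial ps = m}"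
    unfolding expand_image[OF assms, symmetric] by (auto simp: sentences_UNIV prod_list_word_monomial)
  finally show ?thesis .
qed

section \<open>Cutting a list after the elements with a given property\<close>

lemma concat_split_after: "concat (split_after P xs) = xs"
proof (induction xs)
  case (Cons x xs)
  then show ?case by (cases xs; cases "split_after P xs") (auto split: if_splits)
qed simp

lemma split_after_nonempty: "[] \<notin> set (split_after P xs)"
proof (induction xs)
  case (Cons x xs)
  then show ?case by (cases "split_after P xs") auto
qed simp

text \<open>Along a weakly increasing list the separation of all pairs of blocks is a local
  condition: it suffices to compare the two neighbours at each cut.\<close>

lemma sorted_wrt_split_after_iff:
  fixes f :: "'b \<Rightarrow> nat"
  assumes "sorted (map f xs)"
  shows "sorted_wrt (\<lambda>p q. \<forall>x\<in>set p. \<forall>y\<in>set q. f x < f y) (split_after P xs) \<longleftrightarrow>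
    successively (\<lambda>x y. P x \<longrightarrow> f x < f y) xs"
  using assms
proof (induction xs)
  case (Cons x xs)
  show ?case
  proof (cases xs)
    case xs: (Cons y ys)
    obtain b B where bB: "split_after P xs = b # B"
      using xs by (cases "split_after P xs") (auto split: if_splits)
    have hd: "b \<noteq> []" using split_after_nonempty[of P xs] bB by auto
    have "concat (b # B) = y # ys" using concat_split_after[of P xs] unfolding bB by (simp only: xs)
    with hd have b: "y \<in> set b" by (cases b) auto
    have sub: "set b \<union> (\<Union>q\<in>set B. set q) = set xs"
      using arg_cong[OF concat_split_after[of P xs], of set] by (simp add: bB)
    have IH: "sorted_wrt (\<lambda>p q. \<forall>x\<in>set p. \<forall>y\<in>set q. f x < f y) (b # B) \<longleftrightarrow>
        successively (\<lambda>x y. P x \<longrightarrow> f x < f y) xs"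
      using Cons by (simp add: bB)
    have split: "split_after P (x # xs) = (if P x then [x] # b # B else (x # b) # B)"
      using bB by (cases "xs = []") simp_all
    have succ: "successively (\<lambda>x y. P x \<longrightarrow> f x < f y) (x # xs) \<longleftrightarrow>
        (P x \<longrightarrow> f x < f y) \<and> successively (\<lambda>x y. P x \<longrightarrow> f x < f y) xs"
      by (simp add: xs)
    have le: "f x \<le> f y" "\<forall>z\<in>set xs. f y \<le> f z" using Cons.prems by (auto simp: xs)
    show ?thesis
    proof (cases "P x")
      case True
      \<comment> \<open>All values after the cut are at least \<open>f y\<close>, so the comparison
        with the neighbour \<open>y\<close> decides.\<close>
      have "(\<forall>q\<in>set (b # B). \<forall>z\<in>set q. f x < f z) \<longleftrightarrow> f x < f y"
      proof
        assume "f x < f y"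
        moreover have "z \<in> set xs" if "q \<in> set (b # B)" "z \<in> set q" for q z
          using that unfolding sub[symmetric] by auto
        ultimately show "\<forall>q\<in>set (b # B). \<forall>z\<in>set q. f x < f z"
          using le(2) order_less_le_trans by blast
      qed (use b in simp)
      then show ?thesis using True IH unfolding split succ by auto
    next
      case False
      \<comment> \<open>Here \<open>x\<close> joins the block of \<open>y\<close>, and
        \<open>f x \<le> f y\<close> lets it inherit the separation of \<open>y\<close> from the
        later blocks.\<close>
      have "\<forall>q\<in>set B. \<forall>z\<in>set q. f x < f z"
        if "sorted_wrt (\<lambda>p q. \<forall>x\<in>set p. \<forall>y\<in>set q. f x < f y) (b # B)"
        using that b le(1) by fastforce
      then show ?thesis using False IH unfolding split succ by auto
    qed
  qed simp
qed simp

text \<open>Distinctness of \<open>xs\<close> allows an index list to be written as a function on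
  the entries of \<open>xs\<close>. The case of interest is \<open>xs\<close> an interval
  \<open>1..n\<close> cut at the descents of a standard tableau.\<close>

lemma compatible_split_after:
  assumes "distinct xs"
  shows "compatible (map (map c) (split_after P xs)) =
    {map (\<lambda>x. (c x, f x)) xs |f. sorted (map f xs) \<and> (\<forall>x\<in>set xs. 0 < f x) \<and>
       successively (\<lambda>x y. P x \<longrightarrow> f x < f y) xs}" (is "?L = ?R")
proof (intro equalityI subsetI)
  fix ps assume "ps \<in> ?L"
  then obtain Ps where Ps: "sorted (map snd ps)" "\<forall>p\<in>set ps. 0 < snd p" "concat Ps = ps"
      "map (map fst) Ps = map (map c) (split_after P xs)"
      "sorted_wrt (\<lambda>p q. \<forall>x\<in>set p. \<forall>y\<in>set q. snd x < snd y) Ps"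
    by (auto simp: compatible_def)
  have fst: "map fst ps = map c xs"
    using arg_cong[OF Ps(4), of concat] by (simp add: map_concat[symmetric] Ps(3) concat_split_after)
  then have len: "length ps = length xs" by (metis length_map)
  \<comment> \<open>Looks up the index standing at the position of \<open>x\<close>; only the values
    on \<open>xs\<close> matter.\<close>
  define f where "f x = the (map_of (zip xs (map snd ps)) x)" for x
  have f: "f (xs ! k) = snd (ps ! k)" if "k < length xs" for k
    using that len assms by (simp add: f_def map_of_zip_nth)
  have ps: "map (\<lambda>x. (c x, f x)) xs = ps"
  proof (rule nth_equalityI)
    fix k assume "k < length (map (\<lambda>x. (c x, f x)) xs)"
    then have k: "k < length xs" by simp
    then have "fst (ps ! k) = c (xs ! k)"
      using arg_cong[OF fst, of "\<lambda>l. l ! k"] len by simp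
    then show "map (\<lambda>x. (c x, f x)) xs ! k = ps ! k" using k f by (simp add: prod_eq_iff)
  qed (simp add: len)
  \<comment> \<open>Both sides have the same concatenation and the same block lengths.\<close>
  have "Ps = map (map (\<lambda>x. (c x, f x))) (split_after P xs)"
  proof (rule concat_injective)
    show "concat Ps = concat (map (map (\<lambda>x. (c x, f x))) (split_after P xs))"
      by (simp add: Ps(3) map_concat[symmetric] concat_split_after ps)
    show "length Ps = length (map (map (\<lambda>x. (c x, f x))) (split_after P xs))"
      using map_eq_imp_length_eq[OF Ps(4)] by simp
    have "length (Ps ! k) = length (split_after P xs ! k)" if "k < length Ps" for k
      using arg_cong[OF Ps(4), of "\<lambda>l. length (l ! k)"] that map_eq_imp_length_eq[OF Ps(4)] by simp
    then show "\<forall>(x, y)\<in>set (zip Ps (map (map (\<lambda>x. (c x, f x))) (split_after P xs))). length x = length y"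
      by (auto simp: in_set_zip)
  qed
  then have "sorted_wrt (\<lambda>p q. \<forall>x\<in>set p. \<forall>y\<in>set q. f x < f y) (split_after P xs)"
    using Ps(5) by (simp add: sorted_wrt_map)
  moreover have sf: "sorted (map f xs)" using Ps(1) unfolding ps[symmetric] by (simp add: comp_def)
  ultimately have "successively (\<lambda>x y. P x \<longrightarrow> f x < f y) xs"
    by (simp add: sorted_wrt_split_after_iff)
  moreover have "\<forall>x\<in>set xs. 0 < f x" using Ps(2) unfolding ps[symmetric] by simp
  ultimately show "ps \<in> ?R" using ps sf by blast
next
  fix ps assume "ps \<in> ?R"
  then obtain f where f: "ps = map (\<lambda>x. (c x, f x)) xs" "sorted (map f xs)" "\<forall>x\<in>set xs. 0 < f x"
      "successively (\<lambda>x y. P x \<longrightarrow> f x < f y) xs" by blast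
  let ?Ps = "map (map (\<lambda>x. (c x, f x))) (split_after P xs)"
  have "concat ?Ps = ps" by (simp add: map_concat[symmetric] concat_split_after f(1))
  moreover have "map (map fst) ?Ps = map (map c) (split_after P xs)" by simp
  moreover have "sorted_wrt (\<lambda>p q. \<forall>x\<in>set p. \<forall>y\<in>set q. snd x < snd y) ?Ps"
    using f(2,4) by (simp add: sorted_wrt_map sorted_wrt_split_after_iff)
  moreover have "sorted (map snd ps)" "\<forall>p\<in>set ps. 0 < snd p" using f by (auto simp: comp_def)
  ultimately show "ps \<in> ?L" unfolding compatible_def by blast
qed


section \<open>Standardization of colored immaculate tableaux\<close>

text \<open>The list order is the reading order of \<open>type_word\<close>: \<open>rev\<close> puts
  the lowest row first.\<close>

definition boxes :: "'a list list \<Rightarrow> (nat \<times> nat) list" where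
  "boxes J = concat (rev (map (\<lambda>r. map (Pair r) [0..<length (J ! r)]) [0..<length J]))"

definition entry :: "'b list list \<Rightarrow> nat \<times> nat \<Rightarrow> 'b" where
  "entry T b = T ! fst b ! snd b"

definition fill :: "'a list list \<Rightarrow> (nat \<times> nat \<Rightarrow> 'b) \<Rightarrow> 'b list list" where
  "fill J g = map (\<lambda>r. map (\<lambda>k. g (r, k)) [0..<length (J ! r)]) [0..<length J]"

definition reads_before :: "nat \<times> nat \<Rightarrow> nat \<times> nat \<Rightarrow> bool" where
  "reads_before b b' \<longleftrightarrow> fst b' < fst b \<or> fst b = fst b' \<and> snd b < snd b'"

definition precedes :: "nat list list \<Rightarrow> nat \<times> nat \<Rightarrow> nat \<times> nat \<Rightarrow> bool" where
  "precedes T b b' \<longleftrightarrow> entry T b < entry T b' \<or> entry T b = entry T b' \<and> reads_before b b'"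

text \<open>The rank of each box in the order \<open>precedes T\<close>, with \<open>Suc\<close>
  because ranks count from 0 and standard entries from 1.\<close>

definition standardization :: "'a list list \<Rightarrow> nat list list \<Rightarrow> nat list list" where
  "standardization J T = fill J (\<lambda>b. Suc (card {b' \<in> set (boxes J). precedes T b' b}))"

lemma set_boxes: "set (boxes J) = {(r, k). r < length J \<and> k < length (J ! r)}"
  by (auto simp: boxes_def)

lemma length_boxes: "length (boxes J) = sentence_size J"
proof -
  have "map (\<lambda>r. length (J ! r)) [0..<length J] = map length J"
    by (rule nth_equalityI) simp_all
  then show ?thesis
    by (simp add: boxes_def sentence_size_def length_concat rev_map[symmetric] comp_def)
qed

lemma sorted_wrt_reads_before_boxes: "sorted_wrt reads_before (boxes J)"
proof -
  have "sorted_wrt reads_before (concat (rev (map (\<lambda>r. map (Pair r) [0..<l r]) [0..<n])))"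
    for l and n :: nat
    by (induction n) (auto simp: sorted_wrt_append sorted_wrt_map reads_before_def)
  then show ?thesis unfolding boxes_def .
qed

text \<open>If the heads differed, each would occur in the tail of the other list and so precede the
  other, against asymmetry.\<close>

lemma sorted_wrt_set_unique:
  assumes "sorted_wrt R xs" "sorted_wrt R ys" "set xs = set ys" "\<And>x y. R x y \<Longrightarrow> \<not> R y x"
  shows "xs = ys"
  using assms(1-3)
proof (induction xs arbitrary: ys)
  case (Cons x xs)
  then obtain y zs where ys: "ys = y # zs" by (cases ys) auto
  have "x = y" using Cons.prems assms(4) unfolding ys by (metis insertE insertI1 list.simps(15) sorted_wrt.simps(2))
  have "\<not> R x x" using assms(4) by blast
  then have "x \<notin> set xs" "x \<notin> set zs" using Cons.prems \<open>x = y\<close> by (auto simp: ys)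
  then have "set xs = set zs" using Cons.prems(3) \<open>x = y\<close> by (auto simp: ys)
  then show ?case using Cons \<open>x = y\<close> by (simp add: ys)
qed simp

lemma distinct_boxes: "distinct (boxes J)"
proof -
  have "distinct xs" if "sorted_wrt reads_before xs" for xs
    using that by (induction xs) (auto simp: reads_before_def)
  then show ?thesis using sorted_wrt_reads_before_boxes .
qed

lemma card_boxes: "card (set (boxes J)) = sentence_size J"
  using distinct_card[OF distinct_boxes] by (simp add: length_boxes)

section \<open>Tableaux as functions on their boxes\<close>

lemma shape_length:
  assumes "map length T = map length J"
  shows "length T = length J" "r < length J \<Longrightarrow> length (T ! r) = length (J ! r)"
proof -
  show "length T = length J" using map_eq_imp_length_eq[OF assms] .
  then show "length (T ! r) = length (J ! r)" if "r < length J"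
    using arg_cong[OF assms, of "\<lambda>l. l ! r"] that by simp
qed

lemma shape_fill: "map length (fill J g) = map length J"
  by (rule nth_equalityI) (simp_all add: fill_def)

lemma entry_fill: "b \<in> set (boxes J) \<Longrightarrow> entry (fill J g) b = g b"
  by (auto simp: set_boxes entry_def fill_def)

lemma tableau_eqI:
  assumes "map length T = map length J" "map length U = map length J"
    and "\<And>b. b \<in> set (boxes J) \<Longrightarrow> entry T b = entry U b"
  shows "T = U"
proof (rule nth_equalityI)
  show "length T = length U" using shape_length(1)[OF assms(1)] shape_length(1)[OF assms(2)] by simp
  fix r assume "r < length T"
  then have r: "r < length J" using shape_length(1)[OF assms(1)] by simp
  have "T ! r ! k = U ! r ! k" if "k < length (J ! r)" for k
    using r that assms(3)[of "(r, k)"] by (simp add: set_boxes entry_def)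
  then show "T ! r = U ! r"
    using shape_length(2)[OF assms(1) r] shape_length(2)[OF assms(2) r]
    by (intro nth_equalityI) simp_all
qed

lemma set_concat_shape:
  assumes "map length T = map length J"
  shows "set (concat T) = entry T ` set (boxes J)"
proof (intro equalityI subsetI)
  fix x assume "x \<in> set (concat T)"
  then obtain r k where "r < length T" "k < length (T ! r)" "x = T ! r ! k"
    by (auto simp: in_set_conv_nth)
  then show "x \<in> entry T ` set (boxes J)"
    using shape_length[OF assms] by (intro image_eqI[of _ _ "(r, k)"]) (simp_all add: entry_def set_boxes)
next
  fix x assume "x \<in> entry T ` set (boxes J)"
  then obtain r k where "r < length J" "k < length (J ! r)" "x = T ! r ! k"
    by (auto simp: set_boxes entry_def)
  then show "x \<in> set (concat T)"
    using shape_length[OF assms] by (auto intro!: bexI[of _ "T ! r"])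
qed

text \<open>Comparing entries first and positions second is lexicographic. Positions outside the
  diagram have some fixed entry as well, so the order laws need no membership in
  \<open>boxes J\<close>.\<close>

lemma precedes_trans: "precedes T a b \<Longrightarrow> precedes T b c \<Longrightarrow> precedes T a c"
  unfolding precedes_def reads_before_def by auto

lemma precedes_asym: "precedes T a b \<Longrightarrow> \<not> precedes T b a"
  unfolding precedes_def reads_before_def by auto

lemma precedes_total: "a \<noteq> b \<Longrightarrow> precedes T a b \<or> precedes T b a"
  unfolding precedes_def reads_before_def by (cases a; cases b) auto

lemma reads_before_asym: "reads_before a b \<Longrightarrow> \<not> reads_before b a"
  unfolding reads_before_def by auto

text \<open>Passes from the row-by-row definition to a single filter on the list of boxes, whose
  order can then be compared with that of a standardization.\<close>

lemma type_word_eq: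
  assumes "map length T = map length J"
  shows "type_word J T v = map (entry J) (filter (\<lambda>b. entry T b = v) (boxes J))"
proof -
  let ?row = "\<lambda>w row. map fst (filter (\<lambda>(c, x). x = v) (zip w row))"
  have row: "?row (J ! r) (T ! r) =
      map (entry J) (filter (\<lambda>b. entry T b = v) (map (Pair r) [0..<length (J ! r)]))"
    if "r < length J" for r
  proof -
    have "zip (J ! r) (T ! r) = map (\<lambda>k. (J ! r ! k, T ! r ! k)) [0..<length (J ! r)]"
      using shape_length(2)[OF assms that] by (intro nth_equalityI) simp_all
    then show ?thesis by (simp add: filter_map comp_def entry_def)
  qed
  have "map2 ?row J T = map (\<lambda>r. ?row (J ! r) (T ! r)) [0..<length J]"
    using shape_length(1)[OF assms] by (intro nth_equalityI) simp_all
  also have "\<dots> = map (\<lambda>r. map (entry J) (filter (\<lambda>b. entry T b = v)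
      (map (Pair r) [0..<length (J ! r)]))) [0..<length J]"
    using row by (intro map_cong) auto
  finally show ?thesis
    by (simp add: type_word_def boxes_def filter_concat map_concat rev_map comp_def)
qed

text \<open>Restates the tableau conditions box by box, as comparisons that standardization can
  transport. Nonempty rows make \<open>hd\<close> the entry in column 0.\<close>

lemma CIT_iff:
  assumes "[] \<notin> set J"
  shows "CIT J T \<longleftrightarrow> map length T = map length J \<and> (\<forall>b\<in>set (boxes J). 0 < entry T b) \<and>
    (\<forall>r k l. k < l \<longrightarrow> (r, l) \<in> set (boxes J) \<longrightarrow> entry T (r, k) \<le> entry T (r, l)) \<and>
    (\<forall>r s. r < s \<longrightarrow> s < length J \<longrightarrow> entry T (r, 0) < entry T (s, 0))"
proof (cases "map length T = map length J")
  case True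
  note len = shape_length[OF True]
  have pos: "(\<forall>row\<in>set T. \<forall>x\<in>set row. 0 < x) \<longleftrightarrow> (\<forall>b\<in>set (boxes J). 0 < entry T b)"
    using arg_cong[OF set_concat_shape[OF True], of "\<lambda>X. \<forall>x\<in>X. 0 < x"] by simp
  have rows: "(\<forall>row\<in>set T. sorted row) \<longleftrightarrow>
      (\<forall>r k l. k < l \<longrightarrow> (r, l) \<in> set (boxes J) \<longrightarrow> entry T (r, k) \<le> entry T (r, l))"
    using len by (auto simp: all_set_conv_all_nth sorted_wrt_iff_nth_less set_boxes entry_def)
  have "T ! r \<noteq> []" if "r < length J" for r
    using len(2)[OF that] that assms by (metis length_0_conv nth_mem)
  then have "sorted_wrt (<) (map hd T) \<longleftrightarrow>
      (\<forall>r s. r < s \<longrightarrow> s < length J \<longrightarrow> entry T (r, 0) < entry T (s, 0))"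
    using len(1) by (simp add: sorted_wrt_iff_nth_less entry_def hd_conv_nth)
  with pos rows True show ?thesis by (auto simp: CIT_def)
qed (simp add: CIT_def)

text \<open>There are as many boxes as values, so hitting every value already forces distinct
  entries.\<close>

lemma standard_CIT_iff:
  "standard_CIT J U \<longleftrightarrow> CIT J U \<and> bij_betw (entry U) (set (boxes J)) {1..sentence_size J}"
proof (cases "CIT J U")
  case True
  then have shape: "map length U = map length J" by (simp add: CIT_def)
  have "length (concat U) = sentence_size J"
    using shape by (simp add: length_concat sentence_size_def)
  then have "distinct (concat U)" if "set (concat U) = {1..sentence_size J}"
    using that by (intro card_distinct) (simp del: set_concat)
  moreover have "inj_on (entry U) (set (boxes J))"
    if "entry U ` set (boxes J) = {1..sentence_size J}"
    using that by (intro eq_card_imp_inj_on) (simp_all add: card_boxes)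
  ultimately show ?thesis
    using True set_concat_shape[OF shape] by (auto simp: standard_CIT_def bij_betw_def simp del: set_concat)
qed (simp add: standard_CIT_def)

section \<open>Standardization as the ranking of the boxes\<close>

lemma shape_standardization: "map length (standardization J T) = map length J"
  by (simp add: standardization_def shape_fill)

lemma standardization_less_iff:
  assumes "b \<in> set (boxes J)" "b' \<in> set (boxes J)"
  shows "entry (standardization J T) b < entry (standardization J T) b' \<longleftrightarrow> precedes T b b'"
proof -
  have less: "entry (standardization J T) a < entry (standardization J T) a'"
    if "precedes T a a'" "a \<in> set (boxes J)" "a' \<in> set (boxes J)" for a a'
  proof -
    \<comment> \<open>Transitivity gives the inclusion; it is proper because \<open>a\<close> itself
      lies only in the larger set.\<close>
    have "{c \<in> set (boxes J). precedes T c a} \<subset> {c \<in> set (boxes J). precedes T c a'}"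
      using that precedes_trans precedes_asym by blast
    then show ?thesis using that by (simp add: standardization_def entry_fill psubset_card_mono)
  qed
  show ?thesis
    using less[OF _ assms] less[OF _ assms(2,1)] precedes_total[of b b' T] precedes_asym[of T b b']
    by (cases "b = b'") (auto dest: precedes_asym)
qed

lemma bij_betw_standardization:
  "bij_betw (entry (standardization J T)) (set (boxes J)) {1..sentence_size J}"
proof -
  have inj: "inj_on (entry (standardization J T)) (set (boxes J))"
  proof (rule inj_onI, rule ccontr)
    fix a b assume ab: "a \<in> set (boxes J)" "b \<in> set (boxes J)"
      and eq: "entry (standardization J T) a = entry (standardization J T) b" and "a \<noteq> b"
    then consider "precedes T a b" | "precedes T b a" using precedes_total by blast
    then show False
      using standardization_less_iff[OF ab, of T] standardization_less_iff[OF ab(2,1), of T] eq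
      by cases simp_all
  qed
  \<comment> \<open>A box is not its own predecessor, so its rank is below the number of
    boxes.\<close>
  have "card {c \<in> set (boxes J). precedes T c b} < card (set (boxes J))" if "b \<in> set (boxes J)" for b
    using that precedes_asym by (intro psubset_card_mono) blast+
  then have "entry (standardization J T) ` set (boxes J) \<subseteq> {1..sentence_size J}"
    by (auto simp: standardization_def entry_fill card_boxes Suc_le_eq)
  then have "entry (standardization J T) ` set (boxes J) = {1..sentence_size J}"
    by (intro card_subset_eq) (simp_all add: card_image[OF inj] card_boxes)
  with inj show ?thesis by (simp add: bij_betw_def)
qed

text \<open>The predecessors of \<open>b\<close> are the boxes with a smaller entry in
  \<open>U\<close>. Bijectivity matches them with the positive integers below
  \<open>entry U b\<close>, so the rank formula returns that entry.\<close>

lemma standardization_unique: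
  assumes "map length U = map length J" "bij_betw (entry U) (set (boxes J)) {1..sentence_size J}"
    and "\<And>b b'. b \<in> set (boxes J) \<Longrightarrow> b' \<in> set (boxes J) \<Longrightarrow>
           entry U b < entry U b' \<longleftrightarrow> precedes T b b'"
  shows "standardization J T = U"
proof (rule tableau_eqI[OF shape_standardization assms(1)])
  fix b assume b: "b \<in> set (boxes J)"
  have "card {b' \<in> set (boxes J). precedes T b' b} = card {b' \<in> set (boxes J). entry U b' < entry U b}"
    using assms(3)[OF _ b] by (intro arg_cong[of _ _ card]) blast
  also have "\<dots> = card (entry U ` {b' \<in> set (boxes J). entry U b' < entry U b})"
    using assms(2) by (intro card_image[symmetric]) (auto simp: bij_betw_def inj_on_def)
  also have "entry U ` {b' \<in> set (boxes J). entry U b' < entry U b} = {1..<entry U b}"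
  proof (intro equalityI subsetI)
    fix i assume "i \<in> entry U ` {b' \<in> set (boxes J). entry U b' < entry U b}"
    then show "i \<in> {1..<entry U b}" using assms(2) by (auto simp: bij_betw_def)
  next
    fix i assume "i \<in> {1..<entry U b}"
    moreover have "entry U b \<in> {1..sentence_size J}" using assms(2) b by (auto simp: bij_betw_def)
    ultimately have "i \<in> entry U ` set (boxes J)" "i < entry U b"
      using assms(2) by (auto simp: bij_betw_def)
    then show "i \<in> entry U ` {b' \<in> set (boxes J). entry U b' < entry U b}" by auto
  qed
  finally have "Suc (card {b' \<in> set (boxes J). precedes T b' b}) = entry U b"
    using bij_betwE[OF assms(2)] b by auto
  then show "entry (standardization J T) b = entry U b"
    using b by (simp add: standardization_def entry_fill)
qed

text \<open>Within a row, and from the first column downwards, \<open>precedes\<close> only depends on the entries,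
  which is why the tableau conditions are preserved in both directions.\<close>

lemma CIT_transfer:
  assumes J: "[] \<notin> set J"
    and less: "\<And>b b'. b \<in> set (boxes J) \<Longrightarrow> b' \<in> set (boxes J) \<Longrightarrow>
           entry U b < entry U b' \<longleftrightarrow> precedes T b b'"
    and inj: "inj_on (entry U) (set (boxes J))"
    and shape: "map length T = map length J" "map length U = map length J"
    and pos: "\<forall>b\<in>set (boxes J). 0 < entry T b" "\<forall>b\<in>set (boxes J). 0 < entry U b"
  shows "CIT J T \<longleftrightarrow> CIT J U"
proof -
  \<comment> \<open>Ties in a row are broken from left to right, so weak increase in
    \<open>T\<close> is precedence; injectivity makes weak and strict increase in \<open>U\<close>
    agree.\<close>
  have "entry T (r, k) \<le> entry T (r, l) \<longleftrightarrow> entry U (r, k) \<le> entry U (r, l)"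
    if "k < l" "(r, l) \<in> set (boxes J)" for r k l
  proof -
    have k: "(r, k) \<in> set (boxes J)" using that by (auto simp: set_boxes)
    have "entry U (r, k) \<noteq> entry U (r, l)" using inj_onD[OF inj _ k that(2)] that(1) by auto
    then show ?thesis using less[OF k that(2)] that(1) by (auto simp: precedes_def reads_before_def)
  qed
  \<comment> \<open>Lower rows are read first, so a tie in the first column would put the lower box
    first; precedence of the upper box therefore means strict increase.\<close>
  moreover have "entry T (r, 0) < entry T (s, 0) \<longleftrightarrow> entry U (r, 0) < entry U (s, 0)"
    if "r < s" "s < length J" for r s
  proof -
    have "(q, 0) \<in> set (boxes J)" if "q < length J" for q
      using J that by (auto simp: set_boxes) (metis nth_mem)
    then show ?thesis using less[of "(r, 0)" "(s, 0)"] that by (auto simp: precedes_def reads_before_def)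
  qed
  ultimately show ?thesis unfolding CIT_iff[OF J] using shape pos by auto
qed

lemma standard_CIT_standardization:
  assumes "[] \<notin> set J" "CIT J T"
  shows "standard_CIT J (standardization J T)"
proof -
  have "CIT J T \<longleftrightarrow> CIT J (standardization J T)"
  proof (rule CIT_transfer[OF assms(1)])
    show "inj_on (entry (standardization J T)) (set (boxes J))"
      using bij_betw_standardization by (rule bij_betw_imp_inj_on)
    show "\<forall>b\<in>set (boxes J). 0 < entry T b" "map length T = map length J"
      using assms(2) by (simp_all add: CIT_iff[OF assms(1)])
    show "\<forall>b\<in>set (boxes J). 0 < entry (standardization J T) b"
      by (simp add: standardization_def entry_fill)
  qed (simp_all add: standardization_less_iff shape_standardization)
  then show ?thesis
    using assms(2) bij_betw_standardization[of J T] by (simp add: standard_CIT_iff)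
qed


section \<open>The tableaux with a given standardization\<close>

definition box_at :: "'a list list \<Rightarrow> nat list list \<Rightarrow> nat \<Rightarrow> nat \<times> nat" where
  "box_at J U = inv_into (set (boxes J)) (entry U)"

section \<open>Sequences over intervals and the fibers of sorted lists\<close>

lemma successively_upt:
  "successively P [m..<n] \<longleftrightarrow> (\<forall>i. m \<le> i \<and> Suc i < n \<longrightarrow> P i (Suc i))"
proof -
  have "(\<forall>k. Suc k < n - m \<longrightarrow> P (m + k) (Suc (m + k))) \<longleftrightarrow>
      (\<forall>i. m \<le> i \<and> Suc i < n \<longrightarrow> P i (Suc i))"
  proof (intro iffI allI impI)
    fix i assume *: "\<forall>k. Suc k < n - m \<longrightarrow> P (m + k) (Suc (m + k))" "m \<le> i \<and> Suc i < n"
    then show "P i (Suc i)" using *(1)[rule_format, of "i - m"] by auto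
  qed auto
  then show ?thesis by (simp add: successively_conv_nth)
qed

lemma sorted_map_upt:
  fixes f :: "nat \<Rightarrow> nat"
  shows "sorted (map f [m..<n]) \<longleftrightarrow> (\<forall>i. m \<le> i \<and> Suc i < n \<longrightarrow> f i \<le> f (Suc i))"
proof -
  have "sorted (map f [m..<n]) \<longleftrightarrow> successively (\<le>) (map f [m..<n])"
    by (rule successively_conv_sorted_wrt[symmetric]) (auto simp: transp_def)
  then show ?thesis by (simp add: successively_map successively_upt)
qed

text \<open>A sorted list is the concatenation of its fibers in order of value; the induction on
  \<open>n\<close> removes the fiber of the largest value.\<close>

lemma concat_filter_upt:
  fixes f :: "'b \<Rightarrow> nat"
  assumes "sorted (map f ps)" "\<forall>p\<in>set ps. m \<le> f p \<and> f p < n"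
  shows "concat (map (\<lambda>v. filter (\<lambda>p. f p = v) ps) [m..<n]) = ps"
  using assms
proof (induction n arbitrary: ps)
  case (Suc n)
  show ?case
  proof (cases "m \<le> n")
    case True
    let ?qs = "filter (\<lambda>p. f p < n) ps"
    \<comment> \<open>By sortedness the elements of value \<open>n\<close> form the end of the
      list.\<close>
    have split: "ps = ?qs @ filter (\<lambda>p. f p = n) ps"
      using Suc.prems
    proof (induction ps)
      case (Cons p ps)
      show ?case
      proof (cases "f p < n")
        case False
        then have "\<forall>q\<in>set ps. \<not> f q < n" using Cons.prems(1) by auto
        then have "filter (\<lambda>p. f p < n) ps = []" by (simp add: filter_empty_conv)
        then show ?thesis using Cons False by (simp add: less_Suc_eq)
      qed (use Cons in simp)
    qed simp
    have "sorted (map f ?qs)" using Suc.prems(1) by (rule sorted_filter)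
    then have "concat (map (\<lambda>v. filter (\<lambda>p. f p = v) ?qs) [m..<n]) = ?qs"
      using Suc.prems(2) by (intro Suc.IH) auto
    also have "map (\<lambda>v. filter (\<lambda>p. f p = v) ?qs) [m..<n] = map (\<lambda>v. filter (\<lambda>p. f p = v) ps) [m..<n]"
      by (intro map_cong refl) (auto intro!: filter_cong)
    finally show ?thesis using True by (simp add: split[symmetric])
  next
    case False
    then have "ps = []" using Suc.prems(2) by (cases ps) auto
    then show ?thesis using False by simp
  qed
qed simp

text \<open>Attaches to each box its own entry in place of the common value of its fiber, so that
  the result can be recognized as a regrouped list of boxes.\<close>

lemma tableau_monomial_eq:
  assumes shape: "map length T = map length J"
  shows "tableau_monomial J T = pairs_monomial (concat (map
    (\<lambda>v. map (\<lambda>b. (entry J b, entry T b)) (filter (\<lambda>b. entry T b = v) (boxes J)))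
    [1..<Suc (max_entry T)]))"
proof -
  have "map2 word_monomial (map f xs) xs = map (\<lambda>v. word_monomial (f v) v) xs"
    for f :: "nat \<Rightarrow> 'a list" and xs
    by (induction xs) simp_all
  moreover have "word_monomial (type_word J T v) v =
      pairs_monomial (map (\<lambda>b. (entry J b, entry T b)) (filter (\<lambda>b. entry T b = v) (boxes J)))" for v
    unfolding word_monomial_eq type_word_eq[OF shape] map_map
    by (intro arg_cong[of _ _ pairs_monomial] map_cong) auto
  ultimately show ?thesis
    unfolding tableau_monomial_def tableau_type_def pairs_monomial_concat map_map
    by (simp only: comp_def)
qed

text \<open>Fixes one standard tableau \<open>U\<close>; the tableaux standardizing to it are to be
  matched with the compatible lists of its descent composition.\<close>

locale standard_tableau =
  fixes J :: "'a list list" and U :: "nat list list"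
  assumes J: "[] \<notin> set J" and standard: "standard_CIT J U"
begin

abbreviation n :: nat where "n \<equiv> sentence_size J"

abbreviation box :: "nat \<Rightarrow> nat \<times> nat" where "box \<equiv> box_at J U"

text \<open>The boxes are visited in the order given by \<open>U\<close>: the colors depend on
  \<open>U\<close> alone, and \<open>T\<close> supplies the indices.\<close>

abbreviation reading :: "nat list list \<Rightarrow> ('a \<times> nat) list" where
  "reading T \<equiv> map (\<lambda>i. (entry_color J U i, entry T (box i))) [1..<Suc n]"

lemma CIT: "CIT J U" and bij: "bij_betw (entry U) (set (boxes J)) {1..n}"
  using standard by (simp_all add: standard_CIT_iff)

lemma shape: "map length U = map length J"
  using CIT by (simp add: CIT_def)

lemma box_in_boxes: "i \<in> {1..n} \<Longrightarrow> box i \<in> set (boxes J)"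
  and entry_box: "i \<in> {1..n} \<Longrightarrow> entry U (box i) = i"
  using bij by (simp_all add: box_at_def bij_betw_def inv_into_into f_inv_into_f)

lemma box_entry: "b \<in> set (boxes J) \<Longrightarrow> box (entry U b) = b"
  using bij by (simp add: box_at_def bij_betw_def)

lemma entry_range: "b \<in> set (boxes J) \<Longrightarrow> entry U b \<in> {1..n}"
  using bij by (rule bij_betw_apply)

lemma entry_color_eq:
  assumes "i \<in> {1..n}"
  shows "entry_color J U i = entry J (box i)"
  unfolding entry_color_def
proof (rule the_equality)
  have "fst (box i) < length J" "snd (box i) < length (J ! fst (box i))"
    using box_in_boxes[OF assms] by (auto simp: set_boxes)
  then show "\<exists>r k. r < length J \<and> k < length (J ! r) \<and> U ! r ! k = i \<and> J ! r ! k = entry J (box i)"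
    using entry_box[OF assms] by (auto simp: entry_def)
next
  fix c assume "\<exists>r k. r < length J \<and> k < length (J ! r) \<and> U ! r ! k = i \<and> J ! r ! k = c"
  then obtain r k where "(r, k) \<in> set (boxes J)" "entry U (r, k) = i" "entry J (r, k) = c"
    by (auto simp: set_boxes entry_def)
  then show "c = entry J (box i)" using box_entry by metis
qed

lemma in_row_iff:
  assumes "i \<in> {1..n}" "r < length J"
  shows "i \<in> set (U ! r) \<longleftrightarrow> r = fst (box i)"
proof
  assume "i \<in> set (U ! r)"
  then obtain k where "k < length (J ! r)" "U ! r ! k = i"
    using shape_length(2)[OF shape assms(2)] by (auto simp: in_set_conv_nth)
  then have "(r, k) \<in> set (boxes J)" "entry U (r, k) = i"
    using assms(2) by (auto simp: set_boxes entry_def)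
  then show "r = fst (box i)" using box_entry by force
next
  assume "r = fst (box i)"
  moreover have "snd (box i) < length (J ! fst (box i))"
    using box_in_boxes[OF assms(1)] by (auto simp: set_boxes)
  ultimately show "i \<in> set (U ! r)"
    using entry_box[OF assms(1)] shape_length(2)[OF shape assms(2)]
    by (metis entry_def nth_mem)
qed

text \<open>In a common row \<open>i\<close> stands to the left of \<open>Suc i\<close>, because
  rows increase. Hence only the rows decide, and having no descent is the same as agreeing with the
  reading order.\<close>

lemma descent_iff:
  assumes "1 \<le> i" "i < n"
  shows "descent U i \<longleftrightarrow> \<not> reads_before (box i) (box (Suc i))"
proof -
  have i: "i \<in> {1..n}" "Suc i \<in> {1..n}" using assms by auto
  have boxes: "box i \<in> set (boxes J)" "box (Suc i) \<in> set (boxes J)" using box_in_boxes i by auto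
  have "descent U i \<longleftrightarrow> fst (box i) < fst (box (Suc i))"
  proof
    assume "descent U i"
    then obtain r s where rs: "r < s" "s < length J" "i \<in> set (U ! r)" "Suc i \<in> set (U ! s)"
      using shape_length(1)[OF shape] by (auto simp: descent_def)
    then have "r = fst (box i)" "s = fst (box (Suc i))"
      using in_row_iff i by (simp_all del: atLeastAtMost_iff)
    then show "fst (box i) < fst (box (Suc i))" using rs(1) by simp
  next
    assume less: "fst (box i) < fst (box (Suc i))"
    have "fst (box i) < length J" "fst (box (Suc i)) < length J" using boxes by (auto simp: set_boxes)
    then show "descent U i" unfolding descent_def
      using less in_row_iff i shape_length(1)[OF shape]
      by (intro exI[of _ "fst (box i)"] exI[of _ "fst (box (Suc i))"]) (simp del: atLeastAtMost_iff)
  qed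
  moreover have "snd (box i) < snd (box (Suc i))" if "fst (box i) = fst (box (Suc i))"
  proof (rule ccontr)
    assume "\<not> snd (box i) < snd (box (Suc i))"
    then consider "snd (box (Suc i)) < snd (box i)" | "snd (box (Suc i)) = snd (box i)" by linarith
    then show False
    proof cases
      case 1
      moreover have "(fst (box i), snd (box i)) \<in> set (boxes J)" using boxes(1) by simp
      ultimately have "entry U (fst (box i), snd (box (Suc i))) \<le> entry U (fst (box i), snd (box i))"
        using CIT unfolding CIT_iff[OF J] by blast
      moreover have "(fst (box i), snd (box (Suc i))) = box (Suc i)" using that by (simp add: prod_eq_iff)
      ultimately show False using entry_box[OF i(1)] entry_box[OF i(2)] by simp
    next
      case 2
      then have "box (Suc i) = box i" using that by (simp add: prod_eq_iff)
      then show False using entry_box[OF i(1)] entry_box[OF i(2)] by simp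
    qed
  qed
  ultimately show ?thesis unfolding reads_before_def by linarith
qed

lemma precedes_box:
  assumes "standardization J T = U" "i \<in> {1..n}" "j \<in> {1..n}" "i < j"
  shows "precedes T (box i) (box j)"
  using standardization_less_iff[OF box_in_boxes[OF assms(2)] box_in_boxes[OF assms(3)], of T] assms
  by (simp add: entry_box)

text \<open>Precedence of consecutive boxes spreads to all pairs by transitivity; the other
  direction follows from asymmetry, as distinct boxes have distinct entries in
  \<open>U\<close>.\<close>

lemma precedes_iff_entry_less:
  assumes "\<And>i. 1 \<le> i \<Longrightarrow> i < n \<Longrightarrow> precedes T (box i) (box (Suc i))"
    and "b \<in> set (boxes J)" "b' \<in> set (boxes J)"
  shows "entry U b < entry U b' \<longleftrightarrow> precedes T b b'"
proof -
  have step: "precedes T (box i) (box j)" if "1 \<le> i" "i < j" "j \<le> n" for i j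
    using that
  proof (induction j)
    case (Suc j)
    show ?case
    proof (cases "i = j")
      case False
      then have "precedes T (box i) (box j)" "precedes T (box j) (box (Suc j))"
        using Suc.prems assms(1)[of j] by (simp_all add: Suc.IH)
      then show ?thesis by (rule precedes_trans)
    qed (use Suc.prems assms(1)[of i] in simp)
  qed simp
  have less: "precedes T a a'" if "entry U a < entry U a'" "a \<in> set (boxes J)" "a' \<in> set (boxes J)" for a a'
    using step[of "entry U a" "entry U a'"] entry_range[OF that(2)] entry_range[OF that(3)] that
    by (simp add: box_entry)
  show ?thesis
  proof
    assume "entry U b < entry U b'"
    then show "precedes T b b'" using less assms(2,3) by blast
  next
    assume p: "precedes T b b'"
    then have "\<not> entry U b' < entry U b" using less assms(2,3) precedes_asym by blast
    moreover have "b \<noteq> b'" using p precedes_asym by blast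
    then have "entry U b \<noteq> entry U b'"
      using box_entry[OF assms(2)] box_entry[OF assms(3)] by metis
    ultimately show "entry U b < entry U b'" by linarith
  qed
qed

lemma sorted_wrt_precedes:
  assumes "standardization J T = U"
  shows "sorted_wrt (precedes T) (map box [1..<Suc n])"
  unfolding sorted_wrt_map
  by (rule sorted_wrt_mono_rel[OF _ sorted_wrt_upt]) (auto intro: precedes_box[OF assms])

lemma set_map_box: "set (map box [1..<Suc n]) = set (boxes J)"
proof -
  have "{1..<Suc n} = {1..n}" by auto
  then have "set (map box [1..<Suc n]) = box ` {1..n}" by (simp only: set_map set_upt)
  also have "\<dots> = box ` entry U ` set (boxes J)" using bij by (simp add: bij_betw_def)
  also have "\<dots> = set (boxes J)" by (simp add: image_image box_entry)
  finally show ?thesis .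
qed

lemma reading_eq:
  "reading T = map (\<lambda>b. (entry J b, entry T b)) (map box [1..<Suc n])"
  by (auto simp: entry_color_eq simp del: upt_Suc)

text \<open>Along the order of \<open>U\<close> the entries of \<open>T\<close> weakly increase, and
  equal entries appear in reading order. Grouping by value thus reproduces the type of
  \<open>T\<close> already as a list, before any commutation.\<close>

lemma tableau_monomial_reading:
  assumes T: "CIT J T" and std: "standardization J T = U"
  shows "tableau_monomial J T = pairs_monomial (reading T)"
proof -
  have shape_T: "map length T = map length J" using T by (simp add: CIT_def)
  \<comment> \<open>Both filtered lists run through the same boxes in reading order, since
    \<open>precedes\<close> on a fiber is \<open>reads_before\<close>.\<close>
  have fiber: "filter (\<lambda>b. entry T b = v) (boxes J) = filter (\<lambda>b. entry T b = v) (map box [1..<Suc n])" for v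
  proof (rule sorted_wrt_set_unique[of reads_before])
    show "sorted_wrt reads_before (filter (\<lambda>b. entry T b = v) (boxes J))"
      by (intro sorted_wrt_filter sorted_wrt_reads_before_boxes)
    show "sorted_wrt reads_before (filter (\<lambda>b. entry T b = v) (map box [1..<Suc n]))"
      by (rule sorted_wrt_mono_rel[OF _ sorted_wrt_filter[OF sorted_wrt_precedes[OF std]]])
        (auto simp: precedes_def)
    show "set (filter (\<lambda>b. entry T b = v) (boxes J)) =
        set (filter (\<lambda>b. entry T b = v) (map box [1..<Suc n]))"
      unfolding set_filter set_map_box ..
  qed (rule reads_before_asym)
  have "entry T b \<in> {1..max_entry T}" if "b \<in> set (boxes J)" for b
  proof -
    have "entry T b \<in> set (concat T)" using that unfolding set_concat_shape[OF shape_T] by simp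
    then have "entry T b \<le> max_entry T" unfolding max_entry_def by (intro Max_ge) auto
    moreover have "0 < entry T b" using T that unfolding CIT_iff[OF J] by blast
    ultimately show ?thesis by simp
  qed
  then have range: "\<forall>p\<in>set (reading T). 1 \<le> snd p \<and> snd p < Suc (max_entry T)"
    unfolding reading_eq set_map[of _ "map box _"] set_map_box by (auto simp: less_Suc_eq_le)
  have "sorted (map snd (reading T))"
    using sorted_wrt_precedes[OF std] unfolding reading_eq map_map sorted_wrt_map comp_def snd_conv
    by (rule sorted_wrt_mono_rel[rotated]) (auto simp: precedes_def)
  from concat_filter_upt[OF this range]
  have "pairs_monomial (reading T) = pairs_monomial (concat (map
      (\<lambda>v. filter (\<lambda>p. snd p = v) (reading T)) [1..<Suc (max_entry T)]))"
    by (rule arg_cong[symmetric])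
  also have "\<dots> = tableau_monomial J T"
    unfolding tableau_monomial_eq[OF shape_T] reading_eq fiber filter_map comp_def snd_conv map_map ..
  finally show ?thesis ..
qed

text \<open>Weak increase with a jump at each descent is rewritten as the rule that, with
  \<open>f i\<close> in the box of \<open>i\<close>, consecutive boxes are ordered by
  \<open>precedes\<close>.\<close>

lemma compatible_descent_composition:
  "compatible (descent_composition J U) =
    {map (\<lambda>i. (entry_color J U i, f i)) [1..<Suc n] |f. (\<forall>i\<in>{1..n}. 0 < f i) \<and>
      (\<forall>i. 1 \<le> i \<and> i < n \<longrightarrow>
        f i < f (Suc i) \<or> f i = f (Suc i) \<and> reads_before (box i) (box (Suc i)))}"
proof -
  have set: "set [1..<Suc n] = {1..n}" by auto
  have step: "f i \<le> f (Suc i) \<and> (descent U i \<longrightarrow> f i < f (Suc i)) \<longleftrightarrow>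
      f i < f (Suc i) \<or> f i = f (Suc i) \<and> reads_before (box i) (box (Suc i))"
    if "1 \<le> i \<and> i < n" for f :: "nat \<Rightarrow> nat" and i
    using descent_iff[of i] that by auto
  have "(\<forall>i. 1 \<le> i \<and> Suc i < Suc n \<longrightarrow> f i \<le> f (Suc i)) \<and> (\<forall>i\<in>set [1..<Suc n]. 0 < f i) \<and>
      (\<forall>i. 1 \<le> i \<and> Suc i < Suc n \<longrightarrow> descent U i \<longrightarrow> f i < f (Suc i)) \<longleftrightarrow>
      (\<forall>i\<in>{1..n}. 0 < f i) \<and> (\<forall>i. 1 \<le> i \<and> i < n \<longrightarrow>
        f i < f (Suc i) \<or> f i = f (Suc i) \<and> reads_before (box i) (box (Suc i)))" for f :: "nat \<Rightarrow> nat"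
    unfolding set Suc_less_eq using step[of _ f] by meson
  then show ?thesis
    unfolding descent_composition_def compatible_split_after[OF distinct_upt] sorted_map_upt successively_upt
    by (simp only:)
qed

text \<open>A tableau in the fiber gives a compatible list because its consecutive boxes are
  ordered. Conversely an index function is written back into the boxes, and its local rule makes
  \<open>U\<close> the ranking of the result.\<close>

lemma reading_image:
  "reading ` {T. CIT J T \<and> standardization J T = U} = compatible (descent_composition J U)"
  unfolding compatible_descent_composition
proof (intro equalityI subsetI)
  fix ps assume "ps \<in> reading ` {T. CIT J T \<and> standardization J T = U}"
  then obtain T where T: "CIT J T" "standardization J T = U" "ps = reading T" by blast
  have "0 < entry T (box i)" if "i \<in> {1..n}" for i
    using T(1) box_in_boxes[OF that] unfolding CIT_iff[OF J] by blast
  moreover have "entry T (box i) < entry T (box (Suc i)) \<or>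
      entry T (box i) = entry T (box (Suc i)) \<and> reads_before (box i) (box (Suc i))"
    if "1 \<le> i \<and> i < n" for i
    using precedes_box[OF T(2), of i "Suc i"] that unfolding precedes_def by auto
  ultimately show "ps \<in> {map (\<lambda>i. (entry_color J U i, f i)) [1..<Suc n] |f. (\<forall>i\<in>{1..n}. 0 < f i) \<and>
      (\<forall>i. 1 \<le> i \<and> i < n \<longrightarrow>
        f i < f (Suc i) \<or> f i = f (Suc i) \<and> reads_before (box i) (box (Suc i)))}"
    unfolding T(3)
    by (intro CollectI exI[of _ "\<lambda>i. entry T (box i)"]) (auto simp del: upt_Suc)
next
  fix ps :: "('a \<times> nat) list"
  assume "ps \<in> {map (\<lambda>i. (entry_color J U i, f i)) [1..<Suc n] |f. (\<forall>i\<in>{1..n}. 0 < f i) \<and>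
      (\<forall>i. 1 \<le> i \<and> i < n \<longrightarrow>
        f i < f (Suc i) \<or> f i = f (Suc i) \<and> reads_before (box i) (box (Suc i)))}"
  then obtain f where f: "ps = map (\<lambda>i. (entry_color J U i, f i)) [1..<Suc n]"
      "\<forall>i\<in>{1..n}. 0 < f i"
      "\<And>i. 1 \<le> i \<Longrightarrow> i < n \<Longrightarrow>
        f i < f (Suc i) \<or> f i = f (Suc i) \<and> reads_before (box i) (box (Suc i))" by blast
  \<comment> \<open>Puts \<open>f i\<close> into the box that contains \<open>i\<close> in
    \<open>U\<close>.\<close>
  define T where "T = fill J (\<lambda>b. f (entry U b))"
  have T: "entry T b = f (entry U b)" if "b \<in> set (boxes J)" for b
    using that by (simp add: T_def entry_fill)
  have T_box: "entry T (box i) = f i" if "i \<in> {1..n}" for i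
    using T[OF box_in_boxes[OF that]] entry_box[OF that] by simp
  have shape_T: "map length T = map length J" by (simp add: T_def shape_fill)
  have "precedes T (box i) (box (Suc i))" if "1 \<le> i" "i < n" for i
    using f(3)[OF that] T_box[of i] T_box[of "Suc i"] that by (simp add: precedes_def)
  note less = precedes_iff_entry_less[OF this]
  have "standardization J T = U" using shape bij less by (rule standardization_unique)
  moreover have "CIT J T \<longleftrightarrow> CIT J U"
  proof (rule CIT_transfer[OF J less])
    show "inj_on (entry U) (set (boxes J))" using bij by (rule bij_betw_imp_inj_on)
    show "\<forall>b\<in>set (boxes J). 0 < entry T b" using f(2) entry_range T by metis
    show "\<forall>b\<in>set (boxes J). 0 < entry U b" using entry_range by force
  qed (simp_all add: shape_T shape)
  moreover have "ps = reading T" unfolding f(1) by (rule map_cong) (auto simp: T_box)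
  ultimately show "ps \<in> reading ` {T. CIT J T \<and> standardization J T = U}" using CIT by blast
qed

lemma inj_on_reading: "inj_on reading {T. CIT J T \<and> standardization J T = U}"
proof (intro inj_onI; elim CollectE conjE)
  fix T T' assume T: "CIT J T" "CIT J T'" and eq: "reading T = reading T'"
  have "entry T (box i) = entry T' (box i)" if "i \<in> {1..n}" for i
    using eq that by (auto simp: map_eq_conv simp del: upt_Suc)
  then have "entry T b = entry T' b" if "b \<in> set (boxes J)" for b
    using entry_range[OF that] box_entry[OF that] by metis
  then show "T = T'" using T by (intro tableau_eqI) (simp_all add: CIT_def)
qed

text \<open>\<open>reading\<close> is a bijection from the fiber over \<open>U\<close> to the
  compatible lists, and it preserves the monomial.\<close>

lemma colored_F_descent_composition:
  "colored_F (descent_composition J U) m =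
    of_nat (card {T. CIT J T \<and> tableau_monomial J T = m \<and> standardization J T = U})"
proof -
  have "[] \<notin> set (descent_composition J U)"
    using split_after_nonempty by (auto simp: descent_composition_def simp del: upt_Suc)
  then have "colored_F (descent_composition J U) m =
      of_nat (card {ps \<in> compatible (descent_composition J U). pairs_monomial ps = m})"
    by (rule colored_F_eq_card_compatible)
  also have "{ps \<in> compatible (descent_composition J U). pairs_monomial ps = m} =
      reading ` {T. CIT J T \<and> tableau_monomial J T = m \<and> standardization J T = U}"
    unfolding reading_image[symmetric] using tableau_monomial_reading by auto
  also have "card \<dots> = card {T. CIT J T \<and> tableau_monomial J T = m \<and> standardization J T = U}"
    by (intro card_image inj_on_subset[OF inj_on_reading]) auto
  finally show ?thesis .
qed

lemma descent_composition_sentence: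
  assumes "J \<in> sentences A"
  shows "descent_composition J U \<in> sentences A" "sentence_size (descent_composition J U) = n"
proof -
  have concat: "concat (descent_composition J U) = map (entry_color J U) [1..<Suc n]"
    unfolding descent_composition_def by (simp only: map_concat[symmetric] concat_split_after)
  then show "sentence_size (descent_composition J U) = n"
    by (simp add: sentence_size_def[of "descent_composition J U"] del: upt_Suc)
  have "entry_color J U i \<in> A" if "i \<in> {1..n}" for i
  proof -
    have "fst (box i) < length J" "snd (box i) < length (J ! fst (box i))"
      using box_in_boxes[OF that] by (auto simp: set_boxes)
    then have "J ! fst (box i) \<in> set J" "entry J (box i) \<in> set (J ! fst (box i))"
      by (simp_all add: entry_def)
    then show ?thesis using assms that by (auto simp: entry_color_eq sentences_def)
  qed
  then have "set (concat (descent_composition J U)) \<subseteq> A" unfolding concat by auto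
  moreover have "[] \<notin> set (descent_composition J U)"
    using split_after_nonempty by (auto simp: descent_composition_def simp del: upt_Suc)
  ultimately show "descent_composition J U \<in> sentences A" by (auto simp: sentences_def)
qed

end

section \<open>Summation over the standard tableaux\<close>

theorem theorem4p25:
  fixes A :: "'a set" and J :: "'a list list"
  assumes "finite A" and "J \<in> sentences A"
  shows "(dual_immaculate J :: ('a, 'r::comm_ring_1) pc_series) =
           (\<lambda>m. \<Sum>C | C \<in> sentences A \<and> sentence_size C = sentence_size J.
                  of_nat (immaculate_L J C) * colored_F C m)
       \<and> (\<exists>(S :: 'a list list set) (c :: 'a list list \<Rightarrow> nat). finite S \<and> S \<subseteq> sentences A \<and>
            (dual_immaculate J :: ('a, 'r) pc_series) = (\<lambda>m. \<Sum>C\<in>S. of_nat (c C) * colored_F C m))"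
proof -
  let ?S = "{C. C \<in> sentences A \<and> sentence_size C = sentence_size J}"
  let ?U = "{U. standard_CIT J U}"
  have J: "[] \<notin> set J" using assms(2) by (auto simp: sentences_def)
  have fin: "finite ?S" using finite_sentences_size[OF assms(1)] by simp
  have loc: "standard_tableau J U" if "U \<in> ?U" for U
    using that J by (simp add: standard_tableau_def)
  have expansion: "(dual_immaculate J :: ('a, 'r) pc_series) m =
      (\<Sum>C\<in>?S. of_nat (immaculate_L J C) * colored_F C m)" for m
  proof -
    let ?T = "{T. CIT J T \<and> tableau_monomial J T = m}"
    \<comment> \<open>Every tableau has exactly one standardization, which is standard, so the count
      splits into fibers over \<open>?U\<close>.\<close>
    have "card ?T = (\<Sum>U\<in>?U. \<Sum>T\<in>{T \<in> ?T. standardization J T = U}. 1)"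
      using standard_CIT_standardization[OF J]
      by (subst sum.group[OF finite_dual_immaculate_fiber finite_standard_CIT]) auto
    then have "(dual_immaculate J :: ('a, 'r) pc_series) m =
        (\<Sum>U\<in>?U. of_nat (card {T \<in> ?T. standardization J T = U}))"
      by (simp add: dual_immaculate_def monomial_sum_def)
    also have "\<dots> = (\<Sum>U\<in>?U. colored_F (descent_composition J U) m)"
      by (intro sum.cong refl)
        (simp add: standard_tableau.colored_F_descent_composition[OF loc] conj_assoc)
    \<comment> \<open>Descent compositions lie in \<open>?S\<close>, so the standard tableaux can be
      grouped by them. The summand is constant on each group, and the group size is the
      coefficient.\<close>
    also have "\<dots> = (\<Sum>C\<in>?S. \<Sum>U\<in>{U \<in> ?U. descent_composition J U = C}.
        colored_F (descent_composition J U) m)"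
      using standard_tableau.descent_composition_sentence[OF loc assms(2)]
      by (intro sum.group[symmetric] finite_standard_CIT fin) auto
    also have "\<dots> = (\<Sum>C\<in>?S. of_nat (immaculate_L J C) * colored_F C m)"
      by (intro sum.cong refl) (simp add: immaculate_L_def)
    finally show ?thesis .
  qed
  then have "(dual_immaculate J :: ('a, 'r) pc_series) =
      (\<lambda>m. \<Sum>C\<in>?S. of_nat (immaculate_L J C) * colored_F C m)" by blast
  \<comment> \<open>The coefficients \<open>immaculate_L J C\<close> are natural numbers, so the
    same expansion witnesses nonnegativity.\<close>
  then show ?thesis using fin by blast
qed

end
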